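(* For every $\ell>0$, the magnitude of the closed straight line segment $L_\ell$ of length $\ell$ is \[|L_\ell| = \ell/2+1.\]
   Context: A weighting on a finite metric space $(W,d)$ is a choice of real number $w_x$ for each $x\in W$ such that $\sum_{x'\in W} e^{-d(x,x')}w_{x'}=1$ for every $x\in W$. If a weighting exists, the magnitude of $W$ is $|W| := \sum_{x\in W} w_x$; this is independent of the choice of weighting. A metric space $X$ is positive definite if for every finite subspace $W\subseteq X$ the matrix $(e^{-d(x,x')})_{x,x'\in W}$ is positive definite; subspaces of Euclidean space are positive definite, and finite positive definite spaces have a well-defined magnitude. The magnitude of a compact positive definite metric space $X$ is defined as $|X| := \sup\{|W| : W\subseteq X\text{ finite}\}$; equivalently (a result of Meckes), $|X|=\lim_{k}|X_k|$ for any sequence $(X_k)$ of finite subsets of $X$ converging to $X$ in the Hausdorff metric. The segment $L_\ell$ carries the metric of $\mathbb R$. *)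

theory Defs
  imports "HOL-Analysis.Analysis"
begin

(* A finite metric space is a finite subset W of a metric space type, with the induced metric;
   the values of w outside W are irrelevant. *)
definition weighting :: "'a::metric_space set \<Rightarrow> ('a \<Rightarrow> real) \<Rightarrow> bool" where
  "weighting W w \<longleftrightarrow> (\<forall>x\<in>W. (\<Sum>x'\<in>W. exp (- dist x x') * w x') = 1)"

(* Meaningful only if W is finite and has a weighting; see finite_magnitude_eq. *)
definition finite_magnitude :: "'a::metric_space set \<Rightarrow> real" where
  "finite_magnitude W = (THE m. \<exists>w. weighting W w \<and> m = (\<Sum>x\<in>W. w x))"

lemma weighting_sum_unique:
  fixes W :: "'a::metric_space set"
  assumes v: "weighting W v" and w: "weighting W w"
  shows "(\<Sum>x\<in>W. v x) = (\<Sum>x\<in>W. w x)"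
proof -
  have "(\<Sum>x\<in>W. v x) = (\<Sum>x\<in>W. v x * (\<Sum>y\<in>W. exp (- dist x y) * w y))"
    using w by (simp add: weighting_def)
  also have "\<dots> = (\<Sum>x\<in>W. \<Sum>y\<in>W. w y * (exp (- dist y x) * v x))"
    by (simp add: sum_distrib_left dist_commute mult_ac)
  also have "\<dots> = (\<Sum>y\<in>W. \<Sum>x\<in>W. w y * (exp (- dist y x) * v x))"
    by (rule sum.swap)
  also have "\<dots> = (\<Sum>y\<in>W. w y * (\<Sum>x\<in>W. exp (- dist y x) * v x))"
    by (simp add: sum_distrib_left)
  also have "\<dots> = (\<Sum>y\<in>W. w y)"
    using v by (simp add: weighting_def)
  finally show ?thesis .
qed

lemma finite_magnitude_eq:
  assumes "weighting W w"
  shows "finite_magnitude W = (\<Sum>x\<in>W. w x)"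
  unfolding finite_magnitude_def
  by (rule the_equality) (use assms weighting_sum_unique in blast)+

definition positive_definite_space :: "'a::metric_space set \<Rightarrow> bool" where
  "positive_definite_space X \<longleftrightarrow>
     (\<forall>W. finite W \<and> W \<subseteq> X \<longrightarrow>
        (\<forall>v :: 'a \<Rightarrow> real. (\<exists>x\<in>W. v x \<noteq> 0) \<longrightarrow>
           (\<Sum>x\<in>W. \<Sum>x'\<in>W. v x * exp (- dist x x') * v x') > 0))"

(* The supremum is taken in the extended reals, as it need not be finite a priori.
   The magnitude is left unspecified unless X is compact and positive definite. *)
definition magnitude :: "'a::metric_space set \<Rightarrow> ereal" where
  "magnitude X =
     (if compact X \<and> positive_definite_space X
      then (SUP W\<in>{W. finite W \<and> W \<subseteq> X}. ereal (finite_magnitude W))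
      else undefined)"

end

theory Submission
  imports Defs "HOL-Real_Asymp.Real_Asymp"
begin

text \<open>
  On the line, if \<open>m\<close> is the largest point of \<open>W\<close> and \<open>b > m\<close>, then the similarity
  \<open>exp (- dist x b)\<close> is the constant multiple \<open>exp (- (b - m))\<close> of \<open>exp (- dist x m)\<close>
  for all \<open>x \<in> W\<close>. Completing the square therefore shows, by induction from left to right,
  that the line is positive definite; and solving for the weight of the new point shows that
  adding \<open>b\<close> to \<open>W\<close> increases the magnitude by exactly \<open>tanh ((b - m) / 2)\<close>. Since
  \<open>tanh x \<le> x\<close> for \<open>x \<ge> 0\<close>, with asymptotic equality at \<open>0\<close>, the supremum over finite
  subsets of the segment is \<open>1 + l / 2\<close>, approached by finer and finer equally spaced points.
\<close>

section \<open>Positive definiteness of the line\<close>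

lemma exp_dist_right_of:
  fixes x m b :: real
  assumes "x \<le> m" "m \<le> b"
  shows "exp (- dist x b) = exp (- (b - m)) * exp (- dist x m)"
    and "exp (- dist b x) = exp (- (b - m)) * exp (- dist m x)"
  using assms by (simp_all add: dist_real_def abs_if flip: exp_add)

text \<open>With \<open>c = t * v b\<close> and \<open>S\<close> the pairing of \<open>v\<close>
  with the similarities to \<open>m\<close>, the left side is
  \<open>Q + 2 * c * S + (v b)\<^sup>2\<close>. Shifting the value at \<open>m\<close> by
  \<open>c\<close> gives \<open>Q + 2 * c * S + c\<^sup>2\<close>, so the two differ by the last
  term.\<close>

lemma quadratic_form_insert_max:
  fixes W :: "real set" and v :: "real \<Rightarrow> real"
  assumes W: "finite W" "m \<in> W" "\<And>x. x \<in> W \<Longrightarrow> x \<le> m" and "m < b"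
  defines "t \<equiv> exp (- (b - m))"
  defines "v' \<equiv> v(m := v m + t * v b)"
  shows "(\<Sum>x\<in>insert b W. \<Sum>y\<in>insert b W. v x * exp (- dist x y) * v y) =
         (\<Sum>x\<in>W. \<Sum>y\<in>W. v' x * exp (- dist x y) * v' y) + (1 - t\<^sup>2) * (v b)\<^sup>2"
proof -
  define Q S where "Q = (\<Sum>x\<in>W. \<Sum>y\<in>W. v x * exp (- dist x y) * v y)"
    and "S = (\<Sum>x\<in>W. v x * exp (- dist x m))"
  have "b \<notin> W"
    using W(3)[of b] \<open>m < b\<close> by auto
  have row: "(\<Sum>x\<in>W. v x * exp (- dist x b)) = t * S"
    unfolding S_def sum_distrib_left
  proof (rule sum.cong)
    fix x assume "x \<in> W"
    then show "v x * exp (- dist x b) = t * (v x * exp (- dist x m))"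
      using exp_dist_right_of(1)[OF W(3)[of x], of b] \<open>m < b\<close> by (simp add: t_def)
  qed simp
  have "(\<Sum>x\<in>insert b W. \<Sum>y\<in>insert b W. v x * exp (- dist x y) * v y) =
        (v b)\<^sup>2 + (\<Sum>y\<in>W. v b * exp (- dist b y) * v y) + (\<Sum>x\<in>W. v x * exp (- dist x b) * v b) + Q"
    using \<open>finite W\<close> \<open>b \<notin> W\<close> by (simp add: sum.distrib Q_def power2_eq_square)
  also have "(\<Sum>y\<in>W. v b * exp (- dist b y) * v y) = (\<Sum>x\<in>W. v x * exp (- dist x b) * v b)"
    by (simp add: dist_commute mult_ac)
  also have "\<dots> = v b * (t * S)"
    by (simp add: row flip: sum_distrib_right)
  finally have left: "(\<Sum>x\<in>insert b W. \<Sum>y\<in>insert b W. v x * exp (- dist x y) * v y) =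
      Q + 2 * t * v b * S + (v b)\<^sup>2"
    by simp
  define c where "c = t * v b"
  have v': "v' x = v x + (if x = m then c else 0)" for x
    by (simp add: v'_def c_def)
  have inner: "(\<Sum>y\<in>W. v' x * exp (- dist x y) * v' y) =
      v' x * (\<Sum>y\<in>W. exp (- dist x y) * v y) + v' x * exp (- dist x m) * c" for x
  proof -
    have "(\<Sum>y\<in>W. v' x * exp (- dist x y) * v' y) =
        (\<Sum>y\<in>W. v' x * (exp (- dist x y) * v y) + (if y = m then v' x * exp (- dist x m) * c else 0))"
      by (intro sum.cong) (auto simp: v'[of y for y] algebra_simps)
    then show ?thesis
      using W(1,2) by (simp add: sum.distrib sum_distrib_left)
  qed
  \<comment> \<open>Used for two choices of \<open>f\<close>: the row sums against \<open>v\<close>,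
    and the similarity to \<open>m\<close>.\<close>
  have *: "(\<Sum>x\<in>W. v' x * f x) = (\<Sum>x\<in>W. v x * f x) + c * f m" for f
  proof -
    have "(\<Sum>x\<in>W. v' x * f x) = (\<Sum>x\<in>W. v x * f x + (if x = m then c * f m else 0))"
      by (intro sum.cong) (auto simp: v' algebra_simps)
    then show ?thesis
      using W(1,2) by (simp add: sum.distrib)
  qed
  have "(\<Sum>x\<in>W. \<Sum>y\<in>W. v' x * exp (- dist x y) * v' y) =
      (\<Sum>x\<in>W. v' x * (\<Sum>y\<in>W. exp (- dist x y) * v y)) + (\<Sum>x\<in>W. v' x * exp (- dist x m)) * c"
    by (simp add: inner sum.distrib sum_distrib_right)
  also have "\<dots> = Q + c * S + (S + c) * c"
    unfolding * by (simp add: Q_def S_def sum_distrib_left dist_commute mult_ac)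
  finally show ?thesis
    unfolding left c_def by (simp add: power2_eq_square algebra_simps)
qed

lemma positive_definite_space_real: "positive_definite_space (UNIV :: real set)"
proof -
  have "\<forall>v. (\<exists>x\<in>W. v x \<noteq> 0) \<longrightarrow> (\<Sum>x\<in>W. \<Sum>y\<in>W. v x * exp (- dist x y) * v y) > 0"
    if "finite W" for W :: "real set"
    using that
  proof (induction W rule: finite_linorder_max_induct)
    case empty
    then show ?case by simp
  next
    case (insert b W)
    show ?case
    proof (cases "W = {}")
      case True
      then show ?thesis
        by (auto simp: zero_less_mult_iff linorder_neq_iff)
    next
      case False
      define m where "m = Max W"
      have m: "m \<in> W" "\<And>x. x \<in> W \<Longrightarrow> x \<le> m" "m < b"
        using False insert.hyps by (auto simp: m_def)
      define t where "t = exp (- (b - m))"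
      have t: "1 - t\<^sup>2 > 0"
        using \<open>m < b\<close> by (simp add: t_def power2_eq_square flip: exp_add)
      show ?thesis
      proof (intro allI impI)
        fix v :: "real \<Rightarrow> real"
        assume nz: "\<exists>x\<in>insert b W. v x \<noteq> 0"
        define v' where "v' = v(m := v m + t * v b)"
        let ?Q = "\<Sum>x\<in>W. \<Sum>y\<in>W. v' x * exp (- dist x y) * v' y"
        have "?Q + (1 - t\<^sup>2) * (v b)\<^sup>2 > 0"
        \<comment> \<open>If \<open>v b = 0\<close>, the vector is unchanged and nonzero on
          \<open>W\<close>, so \<open>?Q\<close> is positive. Otherwise \<open>v'\<close> may vanish
          on \<open>W\<close>, and strictness comes from the square term.\<close>
        proof (cases "v b = 0")
          case True
          then have "v' = v"
            by (simp add: v'_def)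
          then show ?thesis
            using insert.IH nz True by auto
        next
          case False
          have "?Q \<ge> 0"
          proof (cases "\<exists>x\<in>W. v' x \<noteq> 0")
            case True
            then show ?thesis
              using insert.IH by (intro less_imp_le) blast
          next
            case False
            then show ?thesis by simp
          qed
          moreover have "(1 - t\<^sup>2) * (v b)\<^sup>2 > 0"
            using t False by simp
          ultimately show ?thesis by linarith
        qed
        then show "(\<Sum>x\<in>insert b W. \<Sum>y\<in>insert b W. v x * exp (- dist x y) * v y) > 0"
          using quadratic_form_insert_max[OF insert.hyps(1) m, of v]
          by (simp only: t_def v'_def)
      qed
    qed
  qed
  then show ?thesis
    unfolding positive_definite_space_def by blast
qed

lemma positive_definite_space_subset:
  "positive_definite_space X \<Longrightarrow> Y \<subseteq> X \<Longrightarrow> positive_definite_space Y"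
  unfolding positive_definite_space_def by (meson subset_trans)

section \<open>Weightings and magnitudes of finite sets of reals\<close>

lemma weighting_insert_max:
  fixes W :: "real set"
  assumes W: "finite W" "m \<in> W" "\<And>x. x \<in> W \<Longrightarrow> x \<le> m" and "m < b" and w: "weighting W w"
  obtains w' where "weighting (insert b W) w'"
    and "(\<Sum>x\<in>insert b W. w' x) = (\<Sum>x\<in>W. w x) + tanh ((b - m) / 2)"
proof -
  define t where "t = exp (- (b - m))"
  have t: "t > 0"
    by (simp add: t_def)
  \<comment> \<open>The weight of \<open>b\<close>. Lowering the weight of \<open>m\<close> by
    \<open>t * s\<close> cancels the effect of \<open>b\<close> on all old points; the equation at
    \<open>b\<close> is then \<open>t * (1 - t * s) + s = 1\<close>, which forces this value. The
    total grows by \<open>s - t * s\<close>.\<close>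
  define s where "s = 1 / (1 + t)"
  have s: "t * (1 - t * s) + s = 1" "s * (1 - t) = tanh ((b - m) / 2)"
  proof -
    show "t * (1 - t * s) + s = 1"
      using t by (simp add: s_def divide_simps)
    have "exp (- 2 * ((b - m) / 2)) = t"
      by (simp add: t_def)
    then show "s * (1 - t) = tanh ((b - m) / 2)"
      by (simp only: s_def tanh_real_altdef) simp
  qed
  define w' where "w' = w(m := w m - t * s, b := s)"
  have "b \<notin> W"
    using W(3)[of b] \<open>m < b\<close> by auto
  have on_W: "(\<Sum>x\<in>W. f x * w' x) = (\<Sum>x\<in>W. f x * w x) - f m * (t * s)" for f
  proof -
    have "(\<Sum>x\<in>W. f x * w' x) = (\<Sum>x\<in>W. f x * w x - (if x = m then f m * (t * s) else 0))"
      using \<open>b \<notin> W\<close> by (intro sum.cong) (auto simp: w'_def algebra_simps)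
    then show ?thesis
      using W(1,2) by (simp add: sum_subtractf)
  qed
  \<comment> \<open>Taking \<open>f\<close> to be a row of similarities gives the weighting
    equations; taking \<open>f = 1\<close> gives the total weight.\<close>
  have on_insert: "(\<Sum>x\<in>insert b W. f x * w' x) = f b * s + ((\<Sum>x\<in>W. f x * w x) - f m * (t * s))" for f
    using \<open>finite W\<close> \<open>b \<notin> W\<close> by (simp add: on_W) (simp add: w'_def)
  have "weighting (insert b W) w'"
    unfolding weighting_def
  proof
    fix x assume x: "x \<in> insert b W"
    show "(\<Sum>y\<in>insert b W. exp (- dist x y) * w' y) = 1"
    proof (cases "x = b")
      case True
      have "(\<Sum>y\<in>W. exp (- dist b y) * w y) = t * (\<Sum>y\<in>W. exp (- dist m y) * w y)"
        unfolding sum_distrib_left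
      proof (rule sum.cong)
        fix y assume "y \<in> W"
        then show "exp (- dist b y) * w y = t * (exp (- dist m y) * w y)"
          using exp_dist_right_of(2)[OF W(3)[of y], of b] \<open>m < b\<close> by (simp add: t_def)
      qed simp
      also have "\<dots> = t"
        using w \<open>m \<in> W\<close> by (simp add: weighting_def)
      finally show ?thesis
        using s(1) exp_dist_right_of(2)[of m m b] \<open>m < b\<close> unfolding on_insert True t_def[symmetric]
        by (simp add: t_def[symmetric] algebra_simps)
    next
      case False
      then have "x \<in> W"
        using x by simp
      then have "exp (- dist x b) = t * exp (- dist x m)" "(\<Sum>y\<in>W. exp (- dist x y) * w y) = 1"
        using exp_dist_right_of(1)[OF W(3)[of x], of b] \<open>m < b\<close> w by (simp_all add: t_def weighting_def)
      then show ?thesis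
        unfolding on_insert by simp
    qed
  qed
  moreover have "(\<Sum>x\<in>insert b W. w' x) = (\<Sum>x\<in>W. w x) + tanh ((b - m) / 2)"
    using on_insert[of "\<lambda>_. 1"] s(2) by (simp add: algebra_simps)
  ultimately show ?thesis
    using that by blast
qed

lemma weighting_singleton: "weighting {x} (\<lambda>_. 1)"
  by (simp add: weighting_def)

text \<open>Ensures that the description in \<open>finite_magnitude\<close> denotes for every finite
  set of reals.\<close>

lemma weighting_exists_real:
  fixes W :: "real set"
  assumes "finite W"
  shows "\<exists>w. weighting W w"
  using assms
proof (induction W rule: finite_linorder_max_induct)
  case empty
  then show ?case by (simp add: weighting_def)
next
  case (insert b W)
  show ?case
  proof (cases "W = {}")
    case True
    then show ?thesis
      using weighting_singleton by auto
  next
    case False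
    moreover obtain w where "weighting W w"
      using insert.IH ..
    ultimately show ?thesis
      using weighting_insert_max[of W "Max W" b w] insert.hyps by (metis Max_ge Max_in)
  qed
qed

lemma finite_magnitude_empty: "finite_magnitude {} = 0"
  using finite_magnitude_eq[of "{}" "\<lambda>_. 0"] by (simp add: weighting_def)

lemma finite_magnitude_singleton: "finite_magnitude {x} = 1"
  using finite_magnitude_eq[OF weighting_singleton] by simp

lemma finite_magnitude_insert_max:
  fixes W :: "real set"
  assumes W: "finite W" "m \<in> W" "\<And>x. x \<in> W \<Longrightarrow> x \<le> m" and "m < b"
  shows "finite_magnitude (insert b W) = finite_magnitude W + tanh ((b - m) / 2)"
proof -
  obtain w where "weighting W w"
    using weighting_exists_real[OF \<open>finite W\<close>] ..
  with weighting_insert_max[OF assms this] show ?thesis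
    by (metis finite_magnitude_eq)
qed

section \<open>Upper bound from the gaps, equally spaced sets, and the segment\<close>

lemma tanh_real_le_self:
  fixes x :: real
  assumes "x \<ge> 0"
  shows "tanh x \<le> x"
proof -
  have "(\<lambda>x. x - tanh x) 0 \<le> x - tanh x"
  proof (rule DERIV_nonneg_imp_nondecreasing[OF assms])
    fix y :: real
    show "\<exists>D. ((\<lambda>x. x - tanh x) has_real_derivative D) (at y) \<and> 0 \<le> D"
      \<comment> \<open>The derivative of \<open>tanh\<close> is
        \<open>1 - tanh\<^sup>2\<close>.\<close>
      by (rule exI[of _ "(tanh y)\<^sup>2"]) (auto intro!: derivative_eq_intros)
  qed
  then show ?thesis by simp
qed

text \<open>The leftmost point contributes 1 and each gap at most half its length; the gaps
  telescope to \<open>Max W - Min W\<close>.\<close>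

lemma finite_magnitude_real_le:
  fixes W :: "real set"
  assumes "finite W" "W \<noteq> {}"
  shows "finite_magnitude W \<le> 1 + (Max W - Min W) / 2"
  using assms
proof (induction W rule: finite_linorder_max_induct)
  case empty
  then show ?case by simp
next
  case (insert b W)
  show ?case
  proof (cases "W = {}")
    case True
    then show ?thesis
      by (simp add: finite_magnitude_singleton)
  next
    case False
    have lt: "Max W < b" "Min W < b"
      using False insert.hyps by auto
    have "finite_magnitude (insert b W) = finite_magnitude W + tanh ((b - Max W) / 2)"
      using False insert.hyps lt by (intro finite_magnitude_insert_max) auto
    also have "\<dots> \<le> 1 + (Max W - Min W) / 2 + (b - Max W) / 2"
      using insert.IH[OF False] lt by (intro add_mono tanh_real_le_self) auto
    also have "\<dots> = 1 + (Max (insert b W) - Min (insert b W)) / 2"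
      using False insert.hyps(1) lt
      by (simp add: max_absorb1 min_absorb2 less_imp_le add_divide_distrib diff_divide_distrib del: Max_less_iff)
    finally show ?thesis .
  qed
qed

lemma finite_magnitude_equally_spaced:
  fixes h :: real
  assumes "h > 0"
  shows "finite_magnitude ((\<lambda>i. real i * h) ` {..n}) = 1 + real n * tanh (h / 2)"
proof (induction n)
  case 0
  then show ?case by (simp add: finite_magnitude_singleton)
next
  case (Suc n)
  let ?W = "(\<lambda>i. real i * h) ` {..n}"
  have "finite_magnitude (insert (real (Suc n) * h) ?W) =
      finite_magnitude ?W + tanh ((real (Suc n) * h - real n * h) / 2)"
    using assms by (intro finite_magnitude_insert_max) auto
  also have "real (Suc n) * h - real n * h = h"
    by (simp add: algebra_simps)
  finally show ?case
    by (simp add: Suc atMost_Suc) (simp add: algebra_simps)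
qed

theorem theorem7:
  fixes l :: real
  assumes "l > 0"
  shows "magnitude {0..l} = ereal (l / 2 + 1)"
proof -
  have "(SUP W\<in>{W. finite W \<and> W \<subseteq> {0..l}}. ereal (finite_magnitude W)) = ereal (l / 2 + 1)"
  proof (rule antisym)
    show "(SUP W\<in>{W. finite W \<and> W \<subseteq> {0..l}}. ereal (finite_magnitude W)) \<le> ereal (l / 2 + 1)"
    proof (rule SUP_least)
      fix W assume "W \<in> {W. finite W \<and> W \<subseteq> {0..l}}"
      then have W: "finite W" "W \<subseteq> {0..l}" by auto
      show "ereal (finite_magnitude W) \<le> ereal (l / 2 + 1)"
      \<comment> \<open>The supremum also ranges over the empty set, where \<open>Max\<close> and
        \<open>Min\<close> give no information.\<close>
      proof (cases "W = {}")
        case True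
        then show ?thesis
          using assms by (simp add: finite_magnitude_empty)
      next
        case False
        then have "Max W \<in> {0..l}" "Min W \<in> {0..l}"
          using W Max_in Min_in by blast+
        then show ?thesis
          using finite_magnitude_real_le[OF W(1) False] by (simp add: field_simps)
      qed
    qed
  next
    \<comment> \<open>These \<open>n + 1\<close> points cut the segment into \<open>n\<close> gaps
      of length \<open>l / n\<close>.\<close>
    let ?W = "\<lambda>n. (\<lambda>i. real i * (l / real n)) ` {..n}"
    have "(\<lambda>n. 1 + real n * tanh (l / real n / 2)) \<longlonglongrightarrow> l / 2 + 1"
      by real_asymp
    then have lim: "(\<lambda>n. ereal (1 + real n * tanh (l / real n / 2))) \<longlonglongrightarrow> ereal (l / 2 + 1)"
      by simp
    show "ereal (l / 2 + 1) \<le> (SUP W\<in>{W. finite W \<and> W \<subseteq> {0..l}}. ereal (finite_magnitude W))"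
    \<comment> \<open>Starting at \<open>n = 1\<close> keeps the spacing positive, since
      \<open>l / 0 = 0\<close>.\<close>
    proof (rule LIMSEQ_le_const2[OF lim], intro exI[of _ 1] allI impI)
      fix n :: nat assume "1 \<le> n"
      then have "ereal (1 + real n * tanh (l / real n / 2)) = ereal (finite_magnitude (?W n))"
        using assms by (subst finite_magnitude_equally_spaced) auto
      also have "?W n \<in> {W. finite W \<and> W \<subseteq> {0..l}}"
        using \<open>1 \<le> n\<close> assms by (auto simp: field_simps)
      then have "ereal (finite_magnitude (?W n)) \<le>
          (SUP W\<in>{W. finite W \<and> W \<subseteq> {0..l}}. ereal (finite_magnitude W))"
        by (rule SUP_upper)
      finally show "ereal (1 + real n * tanh (l / real n / 2)) \<le>
          (SUP W\<in>{W. finite W \<and> W \<subseteq> {0..l}}. ereal (finite_magnitude W))" .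
    qed
  qed
  \<comment> \<open>Compactness and positive definiteness select the branch of
    \<open>magnitude\<close> that is the supremum.\<close>
  then show ?thesis
    using positive_definite_space_subset[OF positive_definite_space_real]
    by (simp add: magnitude_def)
qed

end
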